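(* Let $m$ be a positive integer with $\mu(m)\neq 0$ and let $k\in\mathds{N}$. Then $$P_{m,k} := \left\{f \in \mathcal{A} \mid f(n) = 0 \text{ for all } n\in\mathds{N}^+ \text{ with } \zeta(\gcd(m, n)) \leqslant k \right\}$$ is a semi-prime ideal of $\mathcal{A}$.
   Context: $\mathds{N}$ denotes the non-negative integers and $\mathds{N}^+=\mathds{N}\setminus\{0\}$. $\mathcal{A}$ is the ring of arithmetical functions: the set of all functions $f\colon \mathds{N}^+\to\mathds{C}$ with pointwise addition $(f+g)(n)=f(n)+g(n)$ and Dirichlet convolution $(f*g)(n)=\sum_{ij=n}f(i)g(j)$ as multiplication. It is a commutative ring with identity $e$, where $e(1)=1$ and $e(n)=0$ for $n>1$. $\mu$ is the Möbius function, so $\mu(m)\neq0$ means $m$ is square-free. $\zeta(n)$ denotes the number of distinct prime divisors of $n$ (so $\zeta(1)=0$). An ideal $I$ of a commutative ring is semi-prime if, for every ring element $f$ and every positive integer $r$, $f^r\in I$ implies $f\in I$ (powers in $\mathcal{A}$ are taken with respect to $*$). *)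

theory Defs
  imports
    Complex_Main
    "HOL-Library.FuncSet"
    "HOL-Computational_Algebra.Squarefree"
    "HOL-Algebra.Ideal"
begin

text \<open>
  Functions on the positive integers are represented extensionally (with value
  \<^const>\<open>undefined\<close> at \<open>0\<close>), so that equality in the carrier is equality of functions
  on the positive integers.  In the convolution, \<open>n > 0\<close> makes the index set finite and
  forces \<open>i, j > 0\<close>.
\<close>

definition arith_ring :: "(nat \<Rightarrow> complex) ring" where
  "arith_ring =
    \<lparr> carrier = {0<..} \<rightarrow>\<^sub>E UNIV,
      mult = (\<lambda>f g. \<lambda>n\<in>{0<..}. \<Sum>(i, j)\<in>{(i, j). i * j = n}. f i * g j),
      one = (\<lambda>n\<in>{0<..}. if n = 1 then 1 else 0),
      zero = (\<lambda>n\<in>{0<..}. 0),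
      add = (\<lambda>f g. \<lambda>n\<in>{0<..}. f n + g n) \<rparr>"

definition moebius :: "nat \<Rightarrow> int" where
  "moebius n = (if squarefree n then (- 1) ^ card (prime_factors n) else 0)"

definition zeta :: "nat \<Rightarrow> nat" where
  "zeta n = card (prime_factors n)"

text \<open>As in \<^locale>\<open>primeideal\<close>, the ambient ring is part of the locale; an ideal
  need not be proper here.\<close>

locale semiprime_ideal = ideal + cring +
  assumes semiprime:
    "\<lbrakk>f \<in> carrier R; r > 0; f [^] (r::nat) \<in> I\<rbrakk> \<Longrightarrow> f \<in> I"

definition P_set :: "nat \<Rightarrow> nat \<Rightarrow> (nat \<Rightarrow> complex) set" where
  "P_set m k = {f \<in> carrier arith_ring. \<forall>n>0. zeta (gcd m n) \<le> k \<longrightarrow> f n = 0}"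

end

theory Submission
  imports Defs
begin

text \<open>
  Call a set \<open>C\<close> of positive integers, containing \<open>1\<close>, a saturated monoid if
  \<open>i * j \<in> C \<longleftrightarrow> i \<in> C \<and> j \<in> C\<close> for \<open>i, j > 0\<close>. Restricting arithmetical functions to \<open>C\<close> is
  then a homomorphism for the convolution, and functions on \<open>C\<close> have no zero divisors: if \<open>a\<close> and
  \<open>b\<close> are the least elements of \<open>C\<close> at which \<open>f\<close> and \<open>g\<close> do not vanish, the convolution takes the
  value \<open>f a * g b \<noteq> 0\<close> at \<open>a * b\<close> (\<open>conv_nonvanishing\<close>). So the functions vanishing on \<open>C\<close> form
  a prime ideal.

  The ideal \<open>P_set m k\<close> is an intersection of such primes, hence semi-prime. Indeed, if
  \<open>\<zeta>(gcd(m, n)) \<le> k\<close>, the set of all \<open>l > 0\<close> whose common prime divisors with \<open>m\<close> all divide \<open>n\<close>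
  is a saturated monoid; it contains \<open>n\<close>, and each of its elements \<open>l\<close> satisfies
  \<open>\<zeta>(gcd(m, l)) \<le> \<zeta>(gcd(m, n)) \<le> k\<close>.
\<close>

section \<open>The ring of arithmetical functions\<close>

abbreviation conv :: "(nat \<Rightarrow> complex) \<Rightarrow> (nat \<Rightarrow> complex) \<Rightarrow> nat \<Rightarrow> complex" where
  "conv f g \<equiv> f \<otimes>\<^bsub>arith_ring\<^esub> g"

lemma carrier_arith_ring: "carrier arith_ring = {0<..} \<rightarrow>\<^sub>E UNIV"
  by (simp add: arith_ring_def)

lemma arith_eqI:
  assumes "f \<in> carrier arith_ring" "g \<in> carrier arith_ring" "\<And>n. n > 0 \<Longrightarrow> f n = g n"
  shows "f = g"
  using assms unfolding carrier_arith_ring by (intro PiE_ext) auto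

lemma conv_closed: "conv f g \<in> carrier arith_ring"
  by (auto simp: arith_ring_def)

lemma add_closed: "f \<oplus>\<^bsub>arith_ring\<^esub> g \<in> carrier arith_ring"
  by (auto simp: arith_ring_def)

lemma zero_closed: "\<zero>\<^bsub>arith_ring\<^esub> \<in> carrier arith_ring"
  by (auto simp: arith_ring_def)

lemma one_closed: "\<one>\<^bsub>arith_ring\<^esub> \<in> carrier arith_ring"
  by (auto simp: arith_ring_def)

lemma conv_apply:
  "n > 0 \<Longrightarrow> conv f g n = (\<Sum>(i, j)\<in>{(i, j). i * j = n}. f i * g j)"
  by (simp add: arith_ring_def)

lemma add_apply: "n > 0 \<Longrightarrow> (f \<oplus>\<^bsub>arith_ring\<^esub> g) n = f n + g n"
  by (simp add: arith_ring_def)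

lemma zero_apply: "n > 0 \<Longrightarrow> \<zero>\<^bsub>arith_ring\<^esub> n = 0"
  by (simp add: arith_ring_def)

lemma one_apply: "n > 0 \<Longrightarrow> \<one>\<^bsub>arith_ring\<^esub> n = (if n = 1 then 1 else 0)"
  by (simp add: arith_ring_def)

lemma finite_factor_pairs:
  assumes "(n::nat) > 0"
  shows "finite {(i, j). i * j = n}"
proof (rule finite_subset)
  show "{(i, j). i * j = n} \<subseteq> {d. d dvd n} \<times> {d. d dvd n}"
    by auto
qed (use assms in simp)

lemma conv_commute: "conv f g = conv g f"
proof (rule arith_eqI[OF conv_closed conv_closed])
  fix n :: nat assume "n > 0"
  then show "conv f g n = conv g f n"
    unfolding conv_apply[OF \<open>n > 0\<close>]
    by (intro sum.reindex_bij_witness[where i = "\<lambda>(i, j). (j, i)" and j = "\<lambda>(i, j). (j, i)"])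
       (auto simp: mult.commute)
qed

text \<open>Both bracketings are the sum of \<open>f i * g j * h l\<close> over all factorisations \<open>n = i * j * l\<close>.\<close>

lemma conv_assoc: "conv (conv f g) h = conv f (conv g h)"
proof (rule arith_eqI[OF conv_closed conv_closed])
  fix n :: nat assume n: "n > 0"
  let ?D = "\<lambda>n::nat. {(i, j). i * j = n}"
  have "conv (conv f g) h n = (\<Sum>p\<in>?D n. \<Sum>q\<in>?D (fst p). f (fst q) * g (snd q) * h (snd p))"
    unfolding conv_apply[OF n] using n
    by (intro sum.cong) (auto simp: conv_apply sum_distrib_right case_prod_beta intro!: sum.cong)
  also have "\<dots> = (\<Sum>(p, q)\<in>Sigma (?D n) (\<lambda>p. ?D (fst p)). f (fst q) * g (snd q) * h (snd p))"
    using n by (intro sum.Sigma) (auto intro!: finite_factor_pairs)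
  also have "\<dots> = (\<Sum>(p, q)\<in>Sigma (?D n) (\<lambda>p. ?D (snd p)). f (fst p) * (g (fst q) * h (snd q)))"
    by (rule sum.reindex_bij_witness
          [where j = "\<lambda>((a, l), (i, j)). ((i, j * l), (j, l))"
             and i = "\<lambda>((i, b), (j, l)). ((i * j, l), (i, j))"])
       (auto simp: mult.assoc)
  also have "\<dots> = (\<Sum>p\<in>?D n. \<Sum>q\<in>?D (snd p). f (fst p) * (g (fst q) * h (snd q)))"
    using n by (intro sum.Sigma[symmetric]) (auto intro!: finite_factor_pairs)
  also have "\<dots> = conv f (conv g h) n"
    unfolding conv_apply[OF n] using n
    by (intro sum.cong) (auto simp: conv_apply sum_distrib_left case_prod_beta intro!: sum.cong)
  finally show "conv (conv f g) h n = conv f (conv g h) n" .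
qed

lemma one_conv:
  assumes "f \<in> carrier arith_ring"
  shows "conv \<one>\<^bsub>arith_ring\<^esub> f = f"
proof (rule arith_eqI[OF conv_closed assms])
  fix n :: nat assume n: "n > 0"
  have "conv \<one>\<^bsub>arith_ring\<^esub> f n
      = (\<Sum>(i, j)\<in>{(i, j). i * j = n}. \<one>\<^bsub>arith_ring\<^esub> i * f j)"
    by (rule conv_apply[OF n])
  also have "\<dots> = (\<Sum>(i, j)\<in>{(1, n)}. \<one>\<^bsub>arith_ring\<^esub> i * f j)"
    using n by (intro sum.mono_neutral_right finite_factor_pairs) (auto simp: one_apply split: if_splits)
  finally show "conv \<one>\<^bsub>arith_ring\<^esub> f n = f n"
    by (simp add: one_apply)
qed

lemma conv_add_left:
  "conv (f \<oplus>\<^bsub>arith_ring\<^esub> g) h = conv f h \<oplus>\<^bsub>arith_ring\<^esub> conv g h"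
proof (rule arith_eqI[OF conv_closed add_closed])
  fix n :: nat assume n: "n > 0"
  show "conv (f \<oplus>\<^bsub>arith_ring\<^esub> g) h n = (conv f h \<oplus>\<^bsub>arith_ring\<^esub> conv g h) n"
    unfolding add_apply[OF n] conv_apply[OF n] sum.distrib[symmetric] using n
    by (intro sum.cong) (auto simp: add_apply distrib_right)
qed

text \<open>The additive inverse is restricted, so that it is again \<open>undefined\<close> at \<open>0\<close>.\<close>

lemma neg_closed: "(\<lambda>n\<in>{0<..}. - f n) \<in> carrier arith_ring"
  by (auto simp: arith_ring_def)

lemma neg_add: "(\<lambda>n\<in>{0<..}. - f n) \<oplus>\<^bsub>arith_ring\<^esub> f = \<zero>\<^bsub>arith_ring\<^esub>"
  by (rule arith_eqI[OF add_closed zero_closed]) (simp add: add_apply zero_apply)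

lemma cring_arith_ring: "cring arith_ring"
proof (rule cringI)
  show "abelian_group arith_ring"
  proof (rule abelian_groupI)
    fix f assume "f \<in> carrier arith_ring"
    then show "\<zero>\<^bsub>arith_ring\<^esub> \<oplus>\<^bsub>arith_ring\<^esub> f = f"
      by (intro arith_eqI add_closed) (simp_all add: add_apply zero_apply)
    show "\<exists>g\<in>carrier arith_ring. g \<oplus>\<^bsub>arith_ring\<^esub> f = \<zero>\<^bsub>arith_ring\<^esub>"
      using neg_closed neg_add by blast
  qed (auto intro!: arith_eqI add_closed zero_closed simp: add_apply)
  show "comm_monoid arith_ring"
    by (rule comm_monoidI) (simp_all add: conv_closed one_closed conv_assoc one_conv, rule conv_commute)
qed (rule conv_add_left)

section \<open>Functions not vanishing on a saturated monoid\<close>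

locale saturated_monoid =
  fixes C :: "nat set"
  assumes one_mem: "1 \<in> C"
    and pos: "n \<in> C \<Longrightarrow> n > 0"
    and mult_mem_iff: "i > 0 \<Longrightarrow> j > 0 \<Longrightarrow> i * j \<in> C \<longleftrightarrow> i \<in> C \<and> j \<in> C"
begin

lemma conv_nonvanishing:
  assumes "\<exists>n\<in>C. f n \<noteq> 0" and "\<exists>n\<in>C. g n \<noteq> 0"
  shows "\<exists>n\<in>C. conv f g n \<noteq> 0"
proof -
  obtain a where a: "a \<in> C" "f a \<noteq> 0" and a_min: "\<And>i. i \<in> C \<Longrightarrow> f i \<noteq> 0 \<Longrightarrow> a \<le> i"
    using assms(1) exists_least_iff[of "\<lambda>n. n \<in> C \<and> f n \<noteq> 0"] by (metis not_le)
  obtain b where b: "b \<in> C" "g b \<noteq> 0" and b_min: "\<And>j. j \<in> C \<Longrightarrow> g j \<noteq> 0 \<Longrightarrow> b \<le> j"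
    using assms(2) exists_least_iff[of "\<lambda>n. n \<in> C \<and> g n \<noteq> 0"] by (metis not_le)
  have ab: "a > 0" "b > 0" "a * b \<in> C"
    using a b pos mult_mem_iff by auto
  have only: "i = a \<and> j = b" if "i * j = a * b" "f i * g j \<noteq> 0" for i j
  proof -
    have "i > 0" "j > 0"
      using that(1) ab by (auto intro: Nat.gr0I)
    \<comment> \<open>Divisors of an element of \<open>C\<close> lie in \<open>C\<close>, so minimality bounds both factors from below;
      since the product is \<open>a * b\<close>, neither bound can be strict.\<close>
    then have "a \<le> i" "b \<le> j"
      using that ab(3) a_min b_min mult_mem_iff[of i j] by auto
    then show ?thesis
      using that(1) ab mult_less_le_imp_less[of a i b j] mult_le_less_imp_less[of a i b j]
      by (metis le_neq_implies_less less_irrefl zero_le)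
  qed
  have "conv f g (a * b) = (\<Sum>(i, j)\<in>{(i, j). i * j = a * b}. f i * g j)"
    using ab by (simp add: conv_apply)
  also have "\<dots> = (\<Sum>(i, j)\<in>{(a, b)}. f i * g j)"
    using ab only by (intro sum.mono_neutral_right finite_factor_pairs) fastforce+
  also have "\<dots> = f a * g b"
    by simp
  finally show ?thesis
    using a(2) b(2) ab(3) by (intro bexI[of _ "a * b"]) simp_all
qed

lemma power_nonvanishing:
  assumes "\<exists>n\<in>C. f n \<noteq> 0"
  shows "\<exists>n\<in>C. (f [^]\<^bsub>arith_ring\<^esub> (r::nat)) n \<noteq> 0"
proof (induction r)
  case 0
  interpret cring arith_ring by (rule cring_arith_ring)
  show ?case
    using one_mem by (auto simp: one_apply intro!: bexI[of _ 1])
next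
  case (Suc r)
  interpret cring arith_ring by (rule cring_arith_ring)
  show ?case
    using conv_nonvanishing[OF Suc.IH assms] by simp
qed

end

text \<open>
  Equivalently, these are the \<open>l > 0\<close> coprime to every prime that divides \<open>m\<close> but not \<open>n\<close>.
  Listing the primes that may occur avoids forming the product of the excluded ones.
\<close>

lemma saturated_monoid_primes:
  "saturated_monoid {l::nat. l > 0 \<and> (\<forall>p. prime p \<longrightarrow> p dvd m \<longrightarrow> p dvd l \<longrightarrow> p dvd n)}"
  by unfold_locales (auto simp: prime_dvd_mult_iff)

section \<open>The ideals \<open>P_set m k\<close>\<close>

lemma zeta_le_if_prime_divisors:
  assumes "b > 0" and "\<And>p. prime p \<Longrightarrow> p dvd a \<Longrightarrow> p dvd b"
  shows "zeta a \<le> zeta b"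
proof (cases "a = 0")
  case False
  then show ?thesis
    unfolding zeta_def using assms by (intro card_mono) (auto simp: in_prime_factors_iff)
qed (simp add: zeta_def)

lemma P_set_conv:
  assumes f: "f \<in> P_set m k"
  shows "conv f g \<in> P_set m k"
  unfolding P_set_def
proof (safe intro!: conv_closed)
  fix n :: nat
  assume n: "n > 0" and le: "zeta (gcd m n) \<le> k"
  have "f i * g j = 0" if "i * j = n" for i j
  proof -
    have "i > 0"
      using that n by (auto intro: Nat.gr0I)
    moreover have "zeta (gcd m i) \<le> zeta (gcd m n)"
      using that n by (intro zeta_le_if_prime_divisors) auto
    ultimately show ?thesis
      using f le by (auto simp: P_set_def)
  qed
  then show "conv f g n = 0"
    unfolding conv_apply[OF n] by (intro sum.neutral) auto
qed

lemma ideal_P_set: "ideal (P_set m k) arith_ring"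
proof -
  interpret cring arith_ring by (rule cring_arith_ring)
  show ?thesis
  proof (rule idealI)
    show "subgroup (P_set m k) (add_monoid arith_ring)"
    proof (rule add.subgroupI)
      show "P_set m k \<noteq> {}"
        using zero_closed zero_apply by (auto simp: P_set_def)
      fix f assume f: "f \<in> P_set m k"
      then have "\<ominus>\<^bsub>arith_ring\<^esub> f = (\<lambda>n\<in>{0<..}. - f n)"
        by (intro minus_equality neg_add neg_closed) (auto simp: P_set_def)
      then show "\<ominus>\<^bsub>arith_ring\<^esub> f \<in> P_set m k"
        using f neg_closed by (auto simp: P_set_def)
    qed (auto simp: P_set_def add_apply)
  next
    fix f g assume "f \<in> P_set m k"
    then show "conv f g \<in> P_set m k" and "conv g f \<in> P_set m k"
      using P_set_conv conv_commute by metis+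
  qed (rule ring_axioms)
qed

theorem proposition3p25:
  fixes m k :: nat
  assumes "m > 0" and "moebius m \<noteq> 0"
  shows "semiprime_ideal (P_set m k) arith_ring"
proof (intro semiprime_ideal.intro semiprime_ideal_axioms.intro ideal_P_set cring_arith_ring)
  fix f and r :: nat
  assume f: "f \<in> carrier arith_ring" and power: "f [^]\<^bsub>arith_ring\<^esub> r \<in> P_set m k"
  show "f \<in> P_set m k"
    unfolding P_set_def
  proof (safe intro!: f, rule ccontr)
    fix n :: nat
    assume n: "n > 0" "zeta (gcd m n) \<le> k" "f n \<noteq> 0"
    let ?C = "{l. l > 0 \<and> (\<forall>p. prime p \<longrightarrow> p dvd m \<longrightarrow> p dvd l \<longrightarrow> p dvd n)}"
    interpret saturated_monoid ?C by (rule saturated_monoid_primes)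
    have "\<exists>l\<in>?C. f l \<noteq> 0"
      using n by auto
    then obtain l where l: "l \<in> ?C" "(f [^]\<^bsub>arith_ring\<^esub> r) l \<noteq> 0"
      using power_nonvanishing by blast
    have "zeta (gcd m l) \<le> zeta (gcd m n)"
      using l(1) n(1) by (intro zeta_le_if_prime_divisors) auto
    then show False
      using power l n(2) by (auto simp: P_set_def)
  qed
qed

end
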